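(* Let $A:X\to Y^*$ be a linear operator, $C\subseteq X$, $K\subseteq Y$ closed convex cones, and $c\in X^*$, $b\in Y^*$ such that both programs $$(P):\ \inf_x\ \langle c,x\rangle\ \text{ s.t. } Ax-b\in K^*,\ x\in C;\qquad (D):\ \sup_y\ \langle y,b\rangle\ \text{ s.t. } -A^*y+c\in C^*,\ y\in K$$ are feasible. Consider the game $G=(\alpha,\beta,A)$ for some $\alpha\in\mathrm{int}\,C^*$, $\beta\in\mathrm{int}\,K^*$, and let $v$ be its value. Then: (i) If $v\ne0$, then at least one of $(P)$, $(D)$ is strictly feasible. In fact, $\mathrm{val}(P)=\mathrm{val}(D)$ and at least one of the sets $\mathcal S(P)$, $\mathcal S(D)$ is non-empty, convex, and bounded. (ii) If $v=0$ and either $\mathcal B^{I}\cap c^{\perp}=\emptyset$ or $\mathcal B^{II}\cap b^{\perp}=\emptyset$, then at least one of $(P)$, $(D)$ is strictly feasible. In fact, $\mathrm{val}(P)=\mathrm{val}(D)$ and at least one of the sets $\mathcal S(P)$, $\mathcal S(D)$ is non-empty, convex, and bounded. (iii) If $v=0$, $\mathcal B^{I}\cap c^{\perp}\ne\emptyset$ and $\mathcal B^{II}\cap b^{\perp}\ne\emptyset$, then neither of the problems $(P)$, $(D)$ is strictly feasible. In addition, if $\mathcal B^{I}\cap c^{\perp}\cap\mathcal F(P)\ne\emptyset$ and $\mathcal B^{II}\cap b^{\perp}\cap\mathcal F(D)\ne\emptyset$, then $\mathrm{val}(P)=\mathrm{val}(D)=0$ and $\mathcal B^{I}\cap\mathcal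 S(P)\ne\emptyset$, $\mathcal B^{II}\cap\mathcal S(D)\ne\emptyset$.
   Context: $X$ and $Y$ are real reflexive Banach spaces with continuous duals $X^*$, $Y^*$; $\langle w,x\rangle$ ($w\in X^*,x\in X$) and $\langle y,z\rangle$ ($y\in Y,z\in Y^*$) are the canonical pairings; all spaces carry their norm topologies. A convex cone is a set $C$ with $\lambda C\subseteq C$ for all $\lambda\ge0$ and $\kappa C+(1-\kappa)C\subseteq C$ for all $\kappa\in[0,1]$. Dual cones: $C^*=\{w\in X^*:\langle w,x\rangle\ge0\ \forall x\in C\}$, $K^*=\{z\in Y^*:\langle y,z\rangle\ge0\ \forall y\in K\}$; both are assumed to have non-empty interior. The linear operator $A$ is assumed to have an adjoint: for every $y\in Y$ there is a unique $A^*y\in X^*$ with $\langle A^*y,x\rangle=\langle y,Ax\rangle$ for all $x\in X$. $\mathcal F(P)$, $\mathcal F(D)$ are the feasible sets, $\mathrm{val}(P)$, $\mathrm{val}(D)$ the optimal values (infimum, resp. supremum, of the objective over the feasible set), $\mathcal S(P)$, $\mathcal S(D)$ the sets of optimal solutions (feasible points attaining the optimal value). $(P)$ is strictly feasible if there is $x\in C$ with $Ax-b\in\mathrm{int}\,K^*$; $(D)$ is strictly feasible if there is $y\in K$ with $-A^*y+c\in\mathrm{int}\,C^*$. $c^\perp=\{x\in X:\langle c,x\rangle=0\}$, $b^\perp=\{y\in Y:\langle y,b\rangle=0\}$. The game $G=(\alpha,\beta,A)$ is the two-player zero-sum game with (non-empty) strategy sets $S=\{x\in C:\langle\alpha,x\rangle=1\}$,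 $T=\{y\in K:\langle y,\beta\rangle=1\}$ and payoff $u(x,y)=\langle y,Ax\rangle$, maximized by player I over $x\in S$ and minimized by player II over $y\in T$; its lower and upper values $\sup_{x\in S}\inf_{y\in T}u$ and $\inf_{y\in T}\sup_{x\in S}u$ are finite. Its value is $v=\sup_{x\in S}\inf_{y\in T}u(x,y)=\inf_{y\in T}\sup_{x\in S}u(x,y)$ (it exists in this setting). $\mathcal B^I=\{x\in S:u(x,y)\ge v\ \forall y\in T\}$, $\mathcal B^{II}=\{y\in T:u(x,y)\le v\ \forall x\in S\}$ are the sets of optimal strategies. *)

theory Defs
  imports "HOL-Analysis.Analysis"
begin

text \<open>
  The continuous dual of a real normed space \<open>'a\<close> is the space \<open>'a \<Rightarrow>\<^sub>L real\<close> of bounded linear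
  functionals with the operator norm, and both canonical pairings are \<open>blinfun_apply\<close>.  Convex cones
  are sets \<open>C\<close> with \<open>cone C\<close> and \<open>convex C\<close>.
\<close>

definition reflexive_space :: "'a::real_normed_vector itself \<Rightarrow> bool" where
  "reflexive_space _ \<longleftrightarrow>
     (\<forall>\<phi> :: ('a \<Rightarrow>\<^sub>L real) \<Rightarrow>\<^sub>L real. \<exists>x::'a. \<forall>w. blinfun_apply \<phi> w = blinfun_apply w x)"

definition dual_cone :: "'a::real_normed_vector set \<Rightarrow> ('a \<Rightarrow>\<^sub>L real) set" where
  "dual_cone C = {w. \<forall>x\<in>C. 0 \<le> blinfun_apply w x}"

definition perp :: "('a::real_normed_vector \<Rightarrow>\<^sub>L real) \<Rightarrow> 'a set" where
  "perp c = {x. blinfun_apply c x = 0}"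

definition has_dual_adjoint ::
  "('a::real_normed_vector \<Rightarrow> ('b::real_normed_vector \<Rightarrow>\<^sub>L real)) \<Rightarrow> bool" where
  "has_dual_adjoint A \<longleftrightarrow>
     (\<forall>y. \<exists>!w :: 'a \<Rightarrow>\<^sub>L real. \<forall>x. blinfun_apply w x = blinfun_apply (A x) y)"

text \<open>Only meaningful under \<open>has_dual_adjoint A\<close>.\<close>

definition dual_adjoint ::
  "('a::real_normed_vector \<Rightarrow> ('b::real_normed_vector \<Rightarrow>\<^sub>L real)) \<Rightarrow> 'b \<Rightarrow> ('a \<Rightarrow>\<^sub>L real)" where
  "dual_adjoint A y = (THE w. \<forall>x. blinfun_apply w x = blinfun_apply (A x) y)"


subsection \<open>The pair of conic programs\<close>

text \<open>Optimal values live in \<open>ereal\<close>, so that an infeasible or unbounded program has the usual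
  value \<open>\<plusminus>\<infinity>\<close>.\<close>

context
  fixes A :: "'a::real_normed_vector \<Rightarrow> ('b::real_normed_vector \<Rightarrow>\<^sub>L real)"
    and C :: "'a set" and K :: "'b set"
    and b :: "'b \<Rightarrow>\<^sub>L real" and c :: "'a \<Rightarrow>\<^sub>L real"
begin

definition feasible_P :: "'a set" where
  "feasible_P = {x \<in> C. A x - b \<in> dual_cone K}"

definition feasible_D :: "'b set" where
  "feasible_D = {y \<in> K. - dual_adjoint A y + c \<in> dual_cone C}"

definition val_P :: ereal where
  "val_P = (INF x\<in>feasible_P. ereal (blinfun_apply c x))"

definition val_D :: ereal where
  "val_D = (SUP y\<in>feasible_D. ereal (blinfun_apply b y))"

definition solutions_P :: "'a set" where
  "solutions_P = {x \<in> feasible_P. ereal (blinfun_apply c x) = val_P}"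

definition solutions_D :: "'b set" where
  "solutions_D = {y \<in> feasible_D. ereal (blinfun_apply b y) = val_D}"

definition strictly_feasible_P :: bool where
  "strictly_feasible_P \<longleftrightarrow> (\<exists>x\<in>C. A x - b \<in> interior (dual_cone K))"

definition strictly_feasible_D :: bool where
  "strictly_feasible_D \<longleftrightarrow> (\<exists>y\<in>K. - dual_adjoint A y + c \<in> interior (dual_cone C))"

end


subsection \<open>Two-player zero-sum games\<close>

definition strategies :: "('a::real_normed_vector \<Rightarrow>\<^sub>L real) \<Rightarrow> 'a set \<Rightarrow> 'a set" where
  "strategies \<alpha> C = {x \<in> C. blinfun_apply \<alpha> x = 1}"

definition payoff ::
  "('a \<Rightarrow> ('b::real_normed_vector \<Rightarrow>\<^sub>L real)) \<Rightarrow> 'a \<Rightarrow> 'b \<Rightarrow> real" where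
  "payoff A x y = blinfun_apply (A x) y"

definition lower_value :: "'a set \<Rightarrow> 'b set \<Rightarrow> ('a \<Rightarrow> 'b \<Rightarrow> real) \<Rightarrow> ereal" where
  "lower_value S T u = (SUP x\<in>S. INF y\<in>T. ereal (u x y))"

definition upper_value :: "'a set \<Rightarrow> 'b set \<Rightarrow> ('a \<Rightarrow> 'b \<Rightarrow> real) \<Rightarrow> ereal" where
  "upper_value S T u = (INF y\<in>T. SUP x\<in>S. ereal (u x y))"

text \<open>The value is the common finite value of the lower and the upper value; that it exists is not
  part of the definition and has to be derived wherever it is needed.\<close>

definition game_value :: "'a set \<Rightarrow> 'b set \<Rightarrow> ('a \<Rightarrow> 'b \<Rightarrow> real) \<Rightarrow> real" where
  "game_value S T u = (THE v. lower_value S T u = ereal v \<and> upper_value S T u = ereal v)"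

definition optimal_I :: "'a set \<Rightarrow> 'b set \<Rightarrow> ('a \<Rightarrow> 'b \<Rightarrow> real) \<Rightarrow> 'a set" where
  "optimal_I S T u = {x \<in> S. \<forall>y\<in>T. u x y \<ge> game_value S T u}"

definition optimal_II :: "'a set \<Rightarrow> 'b set \<Rightarrow> ('a \<Rightarrow> 'b \<Rightarrow> real) \<Rightarrow> 'b set" where
  "optimal_II S T u = {y \<in> T. \<forall>x\<in>S. u x y \<le> game_value S T u}"

end

theory Submission
  imports Defs
begin

text \<open>
  The proof rests on a theorem of the alternative (\<open>strictly_feasible_P_alternative\<close> and
  \<open>strictly_feasible_D_alternative\<close>).  If the feasible program \<open>(P)\<close> is not strictly feasible, then
  some \<open>y \<in> T\<close> satisfies \<open>b y = 0\<close> and \<open>A x y \<le> 0\<close> for all \<open>x \<in> C\<close>; if the feasible program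
  \<open>(D)\<close> is not strictly feasible, then some \<open>x \<in> S\<close> satisfies \<open>c x = 0\<close> and \<open>A x y \<ge> 0\<close> for
  all \<open>y \<in> K\<close>.  If both fail to be strictly feasible, these two points form a saddle point of the
  game at height 0, so that \<open>v = 0\<close>, \<open>x \<in> B1 \<inter> perp c\<close> and \<open>y \<in> B2 \<inter> perp b\<close>.  Hence
  at least one program is strictly feasible if \<open>v \<noteq> 0\<close> or one of these intersections is empty.  The
  saddle point is constructed directly, and neither a minimax theorem nor weak compactness enters.

  Strict feasibility of one program and feasibility of the other close the duality gap and make the
  solution set of the other program nonempty, convex and bounded (\<open>strictly_feasible_P_duality\<close>,
  \<open>strictly_feasible_D_duality\<close>), as in Slater's theorem.  If \<open>v = 0\<close>, an element of
  \<open>B2 \<inter> perp b\<close> is a nonzero \<open>y \<in> K\<close> at which \<open>A x - b\<close> is nonpositive for every \<open>x \<in> C\<close>,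
  whereas an interior point of \<open>dual_cone K\<close> is positive there; symmetrically for \<open>(D)\<close>.  So
  nonempty intersections exclude strict feasibility, and feasible points in them are optimal by weak
  duality.

  The alternative and strong duality both follow from one Farkas lemma under a Slater condition
  (\<open>conic_farkas\<close>).  This lemma comes from a Hahn-Banach theorem for cones in \<open>V \<times> \<real>\<close>
  (\<open>ex_linear_below_cone\<close>), and reflexivity turns the functional it provides into a point.  The
  statements on \<open>(D)\<close> follow from those on \<open>(P)\<close> by exchanging the programs (\<open>swapped_programs\<close>).
\<close>

section \<open>Linear functionals below convex cones\<close>

lemma convex_cone_atLeast_0: "convex_cone {0::real..}"
  by (auto simp: convex_cone_iff)

lemma convex_cone_UNIV: "convex_cone UNIV"
  by (auto simp: convex_cone_iff)

text \<open>
  The Hahn-Banach theorem for convex cones: a convex cone \<open>E\<close> in \<open>V \<times> \<real>\<close>, lying over every point of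
  \<open>V\<close> and containing no \<open>(0, r)\<close> with \<open>r < 0\<close>, lies above the graph of a linear functional.  With
  \<open>E\<close> the epigraph of a sublinear functional this is the usual statement.  Among the cones containing
  \<open>E\<close> and no \<open>(0, r)\<close> with \<open>r < 0\<close> a maximal one \<open>M\<close> exists by Zorn's lemma, and its lower
  boundary \<open>f z = Inf {r. (z, r) \<in> M}\<close> is linear.
\<close>

lemma ex_linear_below_cone:
  fixes E :: "('v::real_vector \<times> real) set"
  assumes cone: "convex_cone E" and total: "\<And>z. \<exists>r. (z, r) \<in> E"
    and pos: "\<And>r. (0, r) \<in> E \<Longrightarrow> 0 \<le> r"
  obtains f where "linear f" "\<And>z r. (z, r) \<in> E \<Longrightarrow> f z \<le> r"
proof -
  define \<A> where "\<A> = {F. E \<subseteq> F \<and> convex_cone F \<and> (\<forall>r. (0, r) \<in> F \<longrightarrow> 0 \<le> r)}"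
  have "\<exists>M\<in>\<A>. \<forall>X\<in>\<A>. M \<subseteq> X \<longrightarrow> X = M"
  proof (rule subset_Zorn_nonempty)
    show "\<A> \<noteq> {}" using cone pos by (auto simp: \<A>_def)
  next
    fix \<C> assume ne: "\<C> \<noteq> {}" and chain: "subset.chain \<A> \<C>"
    then have sub: "\<C> \<subseteq> \<A>" and tot: "\<And>X Y. X \<in> \<C> \<Longrightarrow> Y \<in> \<C> \<Longrightarrow> X \<subseteq> Y \<or> Y \<subseteq> X"
      by (auto simp: subset_chain_def)
    have cc: "convex_cone X" if "X \<in> \<C>" for X using that sub by (auto simp: \<A>_def)
    have "convex_cone (\<Union>\<C>)"
      unfolding convex_cone_iff
    proof (intro conjI ballI allI impI)
      show "0 \<in> \<Union>\<C>" using ne cc convex_cone_contains_0 by blast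
    next
      fix x y assume "x \<in> \<Union>\<C>" "y \<in> \<Union>\<C>"
      then obtain X Y where "X \<in> \<C>" "Y \<in> \<C>" "x \<in> X" "y \<in> Y" by blast
      then show "x + y \<in> \<Union>\<C>"
        using tot[of X Y] cc convex_cone_add by (metis UnionI subsetD)
    next
      fix x and k :: real assume "x \<in> \<Union>\<C>" "0 \<le> k"
      then show "k *\<^sub>R x \<in> \<Union>\<C>" using cc convex_cone_scaleR by blast
    qed
    then show "\<Union>\<C> \<in> \<A>" using ne sub by (auto simp: \<A>_def)
  qed
  then obtain M where MA: "M \<in> \<A>" and Mmax: "\<And>X. X \<in> \<A> \<Longrightarrow> M \<subseteq> X \<Longrightarrow> X = M" by blast
  then have EM: "E \<subseteq> M" and cM: "convex_cone M" and pM: "\<And>r. (0, r) \<in> M \<Longrightarrow> 0 \<le> r"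
    by (auto simp: \<A>_def)
  have addM: "(x + y, r + s) \<in> M" if "(x, r) \<in> M" "(y, s) \<in> M" for x y r s
    using convex_cone_add[OF cM that] by simp
  have scaleM: "(k *\<^sub>R x, k * r) \<in> M" if "(x, r) \<in> M" "0 \<le> k" for x r k
    using convex_cone_scaleR[OF cM that(2,1)] by simp
  define f where "f z = Inf {r. (z, r) \<in> M}" for z
  have neM: "{r. (z, r) \<in> M} \<noteq> {}" for z using total EM by blast
  have bddM: "bdd_below {r. (z, r) \<in> M}" for z
  proof -
    obtain s where s: "(- z, s) \<in> M" using neM by blast
    have "- s \<le> r" if "(z, r) \<in> M" for r
      using pM[of "r + s"] addM[OF that s] by simp
    then show ?thesis by (auto intro!: bdd_belowI[of _ "- s"])
  qed
  have f_le: "f z \<le> r" if "(z, r) \<in> M" for z r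
    using that bddM by (auto simp: f_def intro!: cInf_lower)
  have f_ge: "l \<le> f z" if "\<And>r. (z, r) \<in> M \<Longrightarrow> l \<le> r" for l z
    using that neM by (auto simp: f_def intro!: cInf_greatest)
  \<comment> \<open>Adjoining the ray through \<open>(- z, - f z)\<close> keeps the cone in the family, so maximality applies.\<close>
  have negM: "(- z, - f z) \<in> M" for z
  proof -
    define R where "R = (\<lambda>t. t *\<^sub>R (- z, - f z)) ` {0..}"
    define F where "F = (\<Union>x\<in>M. \<Union>y\<in>R. {x + y})"
    have "convex_cone R"
      unfolding R_def
      by (intro convex_cone_linear_image conjI convex_cone_atLeast_0 linearI)
        (auto simp: algebra_simps)
    then have cF: "convex_cone F" unfolding F_def using cM by (intro convex_cone_sums)
    have memF: "p + t *\<^sub>R (- z, - f z) \<in> F" if "p \<in> M" "0 \<le> t" for p t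
      using that unfolding F_def R_def by blast
    have MF: "M \<subseteq> F" using memF[of _ 0] by auto
    have "0 \<le> s" if s: "(0, s) \<in> F" for s
    proof -
      obtain r t where m: "(t *\<^sub>R z, r) \<in> M" "0 \<le> t" "s = r - t * f z"
      proof -
        obtain p t where "p \<in> M" "0 \<le> t" "(0, s) = p + t *\<^sub>R (- z, - f z)"
          using s unfolding F_def R_def by blast
        then show thesis by (intro that[of t "snd p"]) (cases p; simp)+
      qed
      show ?thesis
      proof (cases "t = 0")
        case True
        then show ?thesis using m pM by auto
      next
        case False
        then have "(z, r / t) \<in> M"
          using scaleM[OF m(1), of "1 / t"] m by simp
        then show ?thesis using f_le[of z "r / t"] m False by (simp add: field_simps)
      qed
    qed
    then have "F \<in> \<A>" using cF EM MF by (auto simp: \<A>_def)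
    then have "F = M" using Mmax MF by blast
    then show ?thesis using memF[of 0 1] convex_cone_contains_0[OF cM] by simp
  qed
  have f_minus: "f (- z) = - f z" for z
  proof (rule antisym)
    show "f (- z) \<le> - f z" using f_le negM by blast
    have "- f z \<le> r" if "(- z, r) \<in> M" for r
    proof -
      have "- r \<le> f z" by (rule f_ge) (use pM addM[OF that] in fastforce)
      then show ?thesis by simp
    qed
    then show "- f z \<le> f (- z)" by (rule f_ge)
  qed
  have f_mem: "(z, f z) \<in> M" for z using negM[of "- z"] f_minus[of z] by simp
  have f_add: "f (x + y) \<le> f x + f y" for x y by (intro f_le addM f_mem)
  have f_scale: "f (k *\<^sub>R x) \<le> k * f x" if "0 \<le> k" for k x by (intro f_le scaleM f_mem that)
  have f_scale': "f (k *\<^sub>R x) = k * f x" if "0 \<le> k" for k x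
    using f_scale[OF that, of x] f_scale[OF that, of "- x"] by (simp add: f_minus)
  have "linear f"
  proof (rule linearI)
    show "f (x + y) = f x + f y" for x y
      using f_add[of x y] f_add[of "- x" "- y"] f_minus[of "x + y"] by (simp add: f_minus)
    show "f (k *\<^sub>R x) = k *\<^sub>R f x" for k x
      using f_scale'[of k x] f_scale'[of "- k" x] f_minus[of "k *\<^sub>R x"] by (cases "0 \<le> k") auto
  qed
  then show thesis using that f_le EM by blast
qed

text \<open>
  If \<open>E\<close> contains a ball at some height \<open>m\<close>, then it lies over every point and the functional
  below it is bounded.
\<close>

lemma ex_blinfun_below_cone:
  fixes E :: "('v::real_normed_vector \<times> real) set"
  assumes cone: "convex_cone E" and pos: "\<And>r. (0, r) \<in> E \<Longrightarrow> 0 \<le> r"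
    and "0 < e" and ball: "\<And>z. norm z \<le> e \<Longrightarrow> (z, m) \<in> E"
  obtains f :: "'v \<Rightarrow>\<^sub>L real" where "\<And>z r. (z, r) \<in> E \<Longrightarrow> blinfun_apply f z \<le> r"
proof -
  have mem: "(z, norm z * (m / e)) \<in> E" for z
  proof (cases "z = 0")
    case True
    then show ?thesis using convex_cone_contains_0[OF cone] by (simp add: zero_prod_def)
  next
    case False
    have "((e / norm z) *\<^sub>R z, m) \<in> E" using False \<open>0 < e\<close> by (intro ball) simp
    from convex_cone_scaleR[OF cone _ this, of "norm z / e"] False \<open>0 < e\<close>
    show ?thesis by (simp add: field_simps)
  qed
  then have "\<exists>r. (z, r) \<in> E" for z by blast
  from ex_linear_below_cone[OF cone this pos]
  obtain f where lin: "linear f" and f: "\<And>z r. (z, r) \<in> E \<Longrightarrow> f z \<le> r" by blast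
  have "\<bar>f z\<bar> \<le> norm z * (m / e)" for z
    using f[OF mem[of z]] f[OF mem[of "- z"]] by (simp add: linear_neg[OF lin])
  then have "bounded_linear f"
    using lin by (intro bounded_linear_intro[of f "m / e"]) (auto simp: linear_add linear_scale)
  then show thesis using that[of "Blinfun f"] f by (simp add: bounded_linear_Blinfun_apply)
qed

section \<open>Separation and the interior of dual cones\<close>

lemma convex_cone_dual_cone: "convex_cone (dual_cone C)"
  by (auto simp: convex_cone_iff dual_cone_def blinfun.add_left blinfun.scaleR_left)

text \<open>
  Separation of a point \<open>y\<close> from a convex cone \<open>K\<close>, where \<open>d\<close> is at most the distance between
  them.  For \<open>K = {0}\<close> and \<open>d = norm y\<close> the functional \<open>- f\<close> norms \<open>y\<close>.
\<close>

lemma separate_point_cone: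
  fixes K :: "'v::real_normed_vector set"
  assumes K: "convex_cone K" and d: "\<And>k. k \<in> K \<Longrightarrow> d \<le> dist y k" and "0 < d"
  obtains f where "f \<in> dual_cone K" "norm f \<le> 1" "blinfun_apply f y \<le> - d"
proof -
  \<comment> \<open>A functional below this cone is at most the norm, nonpositive on \<open>- K\<close>, and at most \<open>- d\<close> at \<open>y\<close>.\<close>
  define E where "E = {(z, r). \<exists>k\<in>K. \<exists>t\<ge>0. norm (z + k - t *\<^sub>R y) - t * d \<le> r}"
  have K0: "0 \<in> K" by (rule convex_cone_contains_0[OF K])
  have "convex_cone E"
    unfolding convex_cone_iff
  proof (intro conjI ballI allI impI)
    show "0 \<in> E" using K0 by (force simp: E_def zero_prod_def)
  next
    fix p q assume "p \<in> E" "q \<in> E"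
    then obtain z r k t z' r' k' t' where *: "p = (z, r)" "q = (z', r')" "k \<in> K" "k' \<in> K"
      "0 \<le> t" "0 \<le> t'" "norm (z + k - t *\<^sub>R y) - t * d \<le> r"
      "norm (z' + k' - t' *\<^sub>R y) - t' * d \<le> r'"
      by (auto simp: E_def)
    have "norm ((z + z') + (k + k') - (t + t') *\<^sub>R y) - (t + t') * d \<le> r + r'"
      using * norm_triangle_ineq[of "z + k - t *\<^sub>R y" "z' + k' - t' *\<^sub>R y"]
      by (simp add: algebra_simps)
    moreover have "k + k' \<in> K" using * convex_cone_add[OF K] by blast
    ultimately show "p + q \<in> E" using * unfolding E_def by (auto intro!: bexI[of _ "k + k'"] exI[of _ "t + t'"])
  next
    fix p and s :: real assume "p \<in> E" and s: "0 \<le> s"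
    then obtain z r k t where *: "p = (z, r)" "k \<in> K" "0 \<le> t" "norm (z + k - t *\<^sub>R y) - t * d \<le> r"
      by (auto simp: E_def)
    have eq: "s *\<^sub>R z + s *\<^sub>R k - (s * t) *\<^sub>R y = s *\<^sub>R (z + k - t *\<^sub>R y)"
      by (simp add: algebra_simps)
    have "norm (s *\<^sub>R z + s *\<^sub>R k - (s * t) *\<^sub>R y) - (s * t) * d \<le> s * r"
      unfolding eq norm_scaleR using mult_left_mono[OF *(4) s] s by (simp add: right_diff_distrib mult.assoc)
    moreover have "s *\<^sub>R k \<in> K" using * s convex_cone_scaleR[OF K] by blast
    ultimately show "s *\<^sub>R p \<in> E" using * s
      unfolding E_def by (auto intro!: bexI[of _ "s *\<^sub>R k"] exI[of _ "s * t"])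
  qed
  moreover have "0 \<le> r" if "(0, r) \<in> E" for r
  proof -
    obtain k t where *: "k \<in> K" "0 \<le> t" "norm (k - t *\<^sub>R y) - t * d \<le> r"
      using \<open>(0, r) \<in> E\<close> by (auto simp: E_def)
    show ?thesis
    proof (cases "t = 0")
      case True
      then have "norm k \<le> r" using * by simp
      then show ?thesis using norm_ge_zero order_trans by blast
    next
      case False
      have "d \<le> dist y ((1 / t) *\<^sub>R k)" using * by (intro d convex_cone_scaleR[OF K]) auto
      then have "t * d \<le> t * norm (y - (1 / t) *\<^sub>R k)" using * by (intro mult_left_mono) (auto simp: dist_norm)
      also have "\<dots> = norm (t *\<^sub>R (y - (1 / t) *\<^sub>R k))" using * by simp
      also have "t *\<^sub>R (y - (1 / t) *\<^sub>R k) = - (k - t *\<^sub>R y)" using False by (simp add: algebra_simps)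
      finally show ?thesis using * by (simp only: norm_minus_cancel)
    qed
  qed
  moreover have memE: "(z, norm z) \<in> E" for z
    unfolding E_def using K0 by (auto intro!: bexI[of _ 0] exI[of _ 0])
  then have "(z, 1) \<in> E" if "norm z \<le> 1" for z
    unfolding E_def using K0 that by (auto intro!: bexI[of _ 0] exI[of _ 0])
  ultimately obtain f :: "'v \<Rightarrow>\<^sub>L real" where f: "\<And>z r. (z, r) \<in> E \<Longrightarrow> blinfun_apply f z \<le> r"
    using ex_blinfun_below_cone[of E 1 1] by (metis zero_less_one)
  have "f \<in> dual_cone K"
  proof -
    have "(- k, 0) \<in> E" if "k \<in> K" for k
      unfolding E_def using that by (auto intro!: bexI[of _ k] exI[of _ 0])
    from f[OF this] show ?thesis by (simp add: dual_cone_def blinfun.minus_right)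
  qed
  moreover have "norm f \<le> 1"
  proof (rule norm_blinfun_bound)
    show "norm (blinfun_apply f x) \<le> 1 * norm x" for x
      using f[OF memE[of x]] f[OF memE[of "- x"]] by (simp add: blinfun.minus_right)
  qed simp
  moreover have "(y, - d) \<in> E"
    unfolding E_def using K0 by (auto intro!: bexI[of _ 0] exI[of _ 1])
  then have "blinfun_apply f y \<le> - d" by (rule f)
  ultimately show thesis using that by blast
qed

text \<open>
  The interior points of a dual cone are the functionals that are coercive on the cone.  The forward
  direction perturbs \<open>w\<close> by a small multiple of a norming functional.
\<close>

lemma mem_interior_dual_cone_iff:
  fixes C :: "'v::real_normed_vector set"
  shows "w \<in> interior (dual_cone C) \<longleftrightarrow> (\<exists>e>0. \<forall>x\<in>C. e * norm x \<le> blinfun_apply w x)"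
proof
  assume "w \<in> interior (dual_cone C)"
  then obtain e where "0 < e" and e: "cball w e \<subseteq> dual_cone C"
    by (auto simp: mem_interior_cball)
  have "e * norm x \<le> blinfun_apply w x" if "x \<in> C" for x
  proof (cases "x = 0")
    case False
    then have "0 < norm x" by simp
    then obtain f where f: "norm f \<le> 1" "blinfun_apply f x \<le> - norm x"
      using separate_point_cone[of "{0}" "norm x" x] by auto
    have "dist w (w + e *\<^sub>R f) \<le> e" using f(1) \<open>0 < e\<close> by (simp add: dist_norm)
    then have "w + e *\<^sub>R f \<in> dual_cone C" using e by auto
    then have "0 \<le> blinfun_apply w x + e * blinfun_apply f x"
      using that by (auto simp: dual_cone_def blinfun.add_left blinfun.scaleR_left)
    moreover have "e * blinfun_apply f x \<le> e * (- norm x)"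
      using f(2) \<open>0 < e\<close> by (intro mult_left_mono) auto
    ultimately show ?thesis by simp
  qed simp
  then show "\<exists>e>0. \<forall>x\<in>C. e * norm x \<le> blinfun_apply w x" using \<open>0 < e\<close> by blast
next
  assume "\<exists>e>0. \<forall>x\<in>C. e * norm x \<le> blinfun_apply w x"
  then obtain e where "0 < e" and e: "\<And>x. x \<in> C \<Longrightarrow> e * norm x \<le> blinfun_apply w x" by blast
  have "w' \<in> dual_cone C" if "w' \<in> cball w e" for w'
    unfolding dual_cone_def
  proof (intro CollectI ballI)
    fix x assume "x \<in> C"
    have "blinfun_apply (w - w') x \<le> norm (w - w') * norm x"
      using norm_blinfun[of "w - w'" x] by simp
    also have "\<dots> \<le> e * norm x" using that by (intro mult_right_mono) (auto simp: dist_norm)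
    also have "\<dots> \<le> blinfun_apply w x" by (rule e) fact
    finally show "0 \<le> blinfun_apply w' x" by (simp add: blinfun.diff_left)
  qed
  then show "w \<in> interior (dual_cone C)" using \<open>0 < e\<close> by (auto simp: mem_interior_cball)
qed

section \<open>Multipliers for conic systems\<close>

text \<open>
  The duality principle behind both strong duality and the alternative below.  Under the Slater
  condition, and with \<open>z\<close> restricted to \<open>dual_cone K\<close>, nonnegativity of the second component on
  \<open>E\<close> is certified by a multiplier \<open>y\<close>.  A functional below \<open>E - dual_cone K \<times> {0}\<close> is
  evaluation at a point \<open>y\<close> by reflexivity, and \<open>y \<in> K\<close> because it is nonnegative under all
  elements of \<open>dual_cone K\<close> and \<open>K\<close> is closed.
\<close>

lemma conic_farkas:
  fixes K :: "'b::real_normed_vector set" and E :: "(('b \<Rightarrow>\<^sub>L real) \<times> real) set"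
  assumes refl: "reflexive_space TYPE('b)" and "closed K" and K: "convex_cone K"
    and E: "convex_cone E" and pos: "\<And>z r. (z, r) \<in> E \<Longrightarrow> z \<in> dual_cone K \<Longrightarrow> 0 \<le> r"
    and slater: "(z0, r0) \<in> E" "z0 \<in> interior (dual_cone K)"
  obtains y where "y \<in> K" "\<And>z r. (z, r) \<in> E \<Longrightarrow> blinfun_apply z y \<le> r"
proof -
  define N where "N = (\<lambda>k. (- k, 0::real)) ` dual_cone K"
  define F where "F = (\<Union>p\<in>E. \<Union>q\<in>N. {p + q})"
  have "convex_cone N"
    unfolding N_def by (intro convex_cone_linear_image conjI convex_cone_dual_cone linearI) auto
  then have F: "convex_cone F" unfolding F_def using E by (intro convex_cone_sums)
  have memF: "(z - k, r) \<in> F" if "(z, r) \<in> E" "k \<in> dual_cone K" for z k r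
    using that unfolding F_def N_def by force
  have "0 \<le> r" if "(0, r) \<in> F" for r
    using that pos by (auto simp: F_def N_def)
  moreover obtain e where "0 < e" and e: "cball z0 e \<subseteq> dual_cone K"
    using slater(2) by (auto simp: mem_interior_cball)
  moreover have "(z, r0) \<in> F" if "norm z \<le> e" for z
  proof -
    have "z0 - z \<in> dual_cone K" using that e by (auto simp: dist_norm)
    from memF[OF slater(1) this] show ?thesis by simp
  qed
  ultimately obtain \<phi> :: "('b \<Rightarrow>\<^sub>L real) \<Rightarrow>\<^sub>L real"
    where \<phi>: "\<And>z r. (z, r) \<in> F \<Longrightarrow> blinfun_apply \<phi> z \<le> r"
    using ex_blinfun_below_cone[OF F] by metis
  obtain y where y: "\<And>w. blinfun_apply \<phi> w = blinfun_apply w y"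
    using refl by (auto simp: reflexive_space_def)
  have "blinfun_apply z y \<le> r" if "(z, r) \<in> E" for z r
    using \<phi>[OF memF[OF that convex_cone_contains_0[OF convex_cone_dual_cone]]] y by simp
  moreover have "y \<in> K"
  proof (rule ccontr)
    assume "y \<notin> K"
    then obtain d where "0 < d" and d: "ball y d \<subseteq> - K"
      using \<open>closed K\<close> by (metis ComplI closed_def open_contains_ball)
    have "d \<le> dist y k" if "k \<in> K" for k
    proof (rule ccontr)
      assume "\<not> d \<le> dist y k"
      then have "k \<in> ball y d" by simp
      then show False using d that by blast
    qed
    from separate_point_cone[OF K this \<open>0 < d\<close>]
    obtain f where f: "f \<in> dual_cone K" "blinfun_apply f y \<le> - d" by metis
    have "(0 - f, 0) \<in> F"
      using convex_cone_contains_0[OF E] f(1) by (intro memF) (simp_all add: zero_prod_def)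
    from \<phi>[OF this] have "0 \<le> blinfun_apply f y" by (simp add: y blinfun.minus_left)
    then show False using f(2) \<open>0 < d\<close> by simp
  qed
  ultimately show thesis using that by blast
qed

text \<open>
  Any lower bound \<open>p\<close> of a strictly feasible program \<open>(P)\<close> is attained or exceeded by a feasible
  point of \<open>(D)\<close>.  The multiplier for the homogenized program, in which \<open>b\<close> and \<open>p\<close> carry the extra
  scalar variable \<open>t \<ge> 0\<close>, is such a point.
\<close>

lemma conic_strong_duality:
  fixes A :: "'a::real_normed_vector \<Rightarrow> ('b::real_normed_vector \<Rightarrow>\<^sub>L real)"
  assumes refl: "reflexive_space TYPE('b)" and A: "linear A" and C: "convex_cone C"
    and K: "closed K" "convex_cone K"
    and slater: "strictly_feasible_P A C K b"
    and p: "\<And>x. x \<in> feasible_P A C K b \<Longrightarrow> p \<le> blinfun_apply c x"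
  obtains y where "y \<in> K" "\<And>x. x \<in> C \<Longrightarrow> blinfun_apply (A x) y \<le> blinfun_apply c x"
    "p \<le> blinfun_apply b y"
proof -
  define E where
    "E = (\<lambda>(x, t). (A x - t *\<^sub>R b, blinfun_apply c x - t * p)) ` (C \<times> {0..})"
  obtain x0 where x0: "x0 \<in> C" "A x0 - b \<in> interior (dual_cone K)"
    using slater by (auto simp: strictly_feasible_P_def)
  have memE: "(A x - t *\<^sub>R b, blinfun_apply c x - t * p) \<in> E" if "x \<in> C" "0 \<le> t" for x t
    using that by (force simp: E_def)
  have "convex_cone E"
    unfolding E_def
    by (intro convex_cone_linear_image conjI convex_cone_Times C convex_cone_atLeast_0 linearI)
      (auto simp: linear_add[OF A] linear_scale[OF A] blinfun.add_right blinfun.scaleR_right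
        algebra_simps)
  moreover have "0 \<le> r" if mem: "(z, r) \<in> E" and z: "z \<in> dual_cone K" for z r
  proof -
    obtain x t where xt: "x \<in> C" "0 \<le> t" "z = A x - t *\<^sub>R b" "r = blinfun_apply c x - t * p"
      using mem by (auto simp: E_def)
    show ?thesis
    proof (cases "t = 0")
      case False
      \<comment> \<open>Rescaling to \<open>t = 1\<close> gives a feasible point of \<open>(P)\<close>.\<close>
      have "A ((1 / t) *\<^sub>R x) - b = (1 / t) *\<^sub>R z"
        using xt False by (simp add: linear_scale[OF A] scaleR_diff_right)
      then have "A ((1 / t) *\<^sub>R x) - b \<in> dual_cone K"
        using convex_cone_scaleR[OF convex_cone_dual_cone _ z, of "1 / t"] xt by simp
      then have "p \<le> blinfun_apply c ((1 / t) *\<^sub>R x)"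
        using xt convex_cone_scaleR[OF C, of "1 / t" x] by (intro p) (simp add: feasible_P_def)
      then show ?thesis using xt False by (simp add: blinfun.scaleR_right field_simps)
    next
      case True
      \<comment> \<open>Here \<open>x\<close> is a recession direction of \<open>(P)\<close>, so a negative cost would make \<open>(P)\<close> unbounded.\<close>
      have ray: "p \<le> blinfun_apply c x0 + s * r" if "0 \<le> s" for s
      proof -
        have "(A x0 - b) + s *\<^sub>R z \<in> dual_cone K"
          using x0(2) interior_subset z that
          by (intro convex_cone_add[OF convex_cone_dual_cone]
              convex_cone_scaleR[OF convex_cone_dual_cone]) auto
        also have "(A x0 - b) + s *\<^sub>R z = A (x0 + s *\<^sub>R x) - b"
          using xt True by (simp add: linear_add[OF A] linear_scale[OF A])
        finally have "p \<le> blinfun_apply c (x0 + s *\<^sub>R x)"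
          using x0 xt that convex_cone_add[OF C x0(1) convex_cone_scaleR[OF C]]
          by (intro p) (simp add: feasible_P_def)
        then show ?thesis using xt True by (simp add: blinfun.add_right blinfun.scaleR_right)
      qed
      show ?thesis
      proof (rule ccontr)
        assume "\<not> 0 \<le> r"
        then show False
          using ray[of 0] ray[of "(blinfun_apply c x0 - p + 1) / (- r)"] by (simp add: field_simps)
      qed
    qed
  qed
  moreover have "(A x0 - b, blinfun_apply c x0 - p) \<in> E"
    using memE[OF x0(1), of 1] by simp
  ultimately obtain y where "y \<in> K" and y: "\<And>z r. (z, r) \<in> E \<Longrightarrow> blinfun_apply z y \<le> r"
    using conic_farkas[OF refl K, of E] x0(2) by metis
  have "blinfun_apply (A x) y \<le> blinfun_apply c x" if "x \<in> C" for x
    using y[OF memE[OF that, of 0]] by simp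
  moreover have "p \<le> blinfun_apply b y"
    using y[OF memE[OF convex_cone_contains_0[OF C], of 1]] linear_0[OF A]
    by (simp add: blinfun.minus_left)
  ultimately show thesis using that \<open>y \<in> K\<close> by blast
qed

text \<open>
  The link between strict feasibility and the game: if \<open>(P)\<close> is feasible but not strictly feasible,
  then player II has a strategy that is orthogonal to \<open>b\<close> and keeps the payoff nonpositive.
\<close>

lemma strictly_feasible_P_alternative:
  fixes A :: "'a::real_normed_vector \<Rightarrow> ('b::real_normed_vector \<Rightarrow>\<^sub>L real)"
  assumes refl: "reflexive_space TYPE('b)" and A: "linear A" and C: "convex_cone C"
    and K: "closed K" "convex_cone K"
    and \<beta>: "\<beta> \<in> interior (dual_cone K)"
    and feas: "feasible_P A C K b \<noteq> {}" and not_strict: "\<not> strictly_feasible_P A C K b"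
  obtains y where "y \<in> strategies \<beta> K" "blinfun_apply b y = 0"
    "\<And>x. x \<in> C \<Longrightarrow> blinfun_apply (A x) y \<le> 0"
proof -
  \<comment> \<open>The program: minimize \<open>s\<close> subject to \<open>A x + s \<beta> - t b \<in> dual_cone K\<close>, with \<open>x \<in> C\<close>, \<open>t \<ge> 0\<close> and
    free \<open>s\<close>.  It has a negative value only if \<open>(P)\<close> is strictly feasible.\<close>
  define E where
    "E = (\<lambda>(x, s, t). (A x + s *\<^sub>R \<beta> - t *\<^sub>R b, s)) ` (C \<times> (UNIV::real set) \<times> {0..})"
  have memE: "(A x + s *\<^sub>R \<beta> - t *\<^sub>R b, s) \<in> E" if "x \<in> C" "0 \<le> t" for x s t
    using that by (force simp: E_def)
  obtain x1 where x1: "x1 \<in> C" "A x1 - b \<in> dual_cone K" using feas by (auto simp: feasible_P_def)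
  have "convex_cone E"
    unfolding E_def
    by (intro convex_cone_linear_image conjI convex_cone_Times C convex_cone_atLeast_0
        convex_cone_UNIV linearI)
      (auto simp: linear_add[OF A] linear_scale[OF A] algebra_simps)
  moreover have "0 \<le> s" if mem: "(z, s) \<in> E" and z: "z \<in> dual_cone K" for z s
  proof (rule ccontr)
    assume "\<not> 0 \<le> s"
    obtain x t where xt: "x \<in> C" "0 \<le> t" "z = A x + s *\<^sub>R \<beta> - t *\<^sub>R b"
      using mem by (auto simp: E_def)
    obtain e where "0 < e" and e: "\<And>y. y \<in> K \<Longrightarrow> e * norm y \<le> blinfun_apply \<beta> y"
      using \<beta> by (auto simp: mem_interior_dual_cone_iff)
    \<comment> \<open>Adding the feasible point \<open>x1\<close> covers \<open>t = 0\<close> as well, where \<open>x\<close> alone cannot be rescaled.\<close>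
    define x' where "x' = (1 / (1 + t)) *\<^sub>R (x1 + x)"
    have "x' \<in> C"
      unfolding x'_def using xt x1 by (intro convex_cone_scaleR[OF C] convex_cone_add[OF C]) auto
    moreover have "((- s) * e / (1 + t)) * norm y \<le> blinfun_apply (A x' - b) y" if "y \<in> K" for y
    proof -
      have "(- s) * (e * norm y) \<le> (- s) * blinfun_apply \<beta> y"
        using e[OF that] \<open>\<not> 0 \<le> s\<close> by (intro mult_left_mono) auto
      moreover have "0 \<le> blinfun_apply (A x1 - b) y" "0 \<le> blinfun_apply z y"
        using x1 z that by (auto simp: dual_cone_def)
      ultimately have "(- s) * (e * norm y)
          \<le> blinfun_apply (A x1) y + blinfun_apply (A x) y - (1 + t) * blinfun_apply b y"
        by (simp add: xt(3) blinfun.add_left blinfun.diff_left blinfun.scaleR_left algebra_simps)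
      then have "(- s) * (e * norm y) / (1 + t)
          \<le> (blinfun_apply (A x1) y + blinfun_apply (A x) y - (1 + t) * blinfun_apply b y) / (1 + t)"
        using xt by (intro divide_right_mono) auto
      also have "\<dots> = blinfun_apply (A x' - b) y"
        using xt by (simp add: x'_def linear_add[OF A] linear_scale[OF A] blinfun.add_left
            blinfun.diff_left blinfun.scaleR_left add_divide_distrib diff_divide_distrib)
      finally show ?thesis by simp
    qed
    moreover have "0 < (- s) * e / (1 + t)" using \<open>\<not> 0 \<le> s\<close> \<open>0 < e\<close> xt(2)
      by (intro divide_pos_pos mult_pos_pos) auto
    ultimately have "strictly_feasible_P A C K b"
      unfolding strictly_feasible_P_def mem_interior_dual_cone_iff by blast
    then show False using not_strict by blast
  qed
  moreover have C0: "0 \<in> C" by (rule convex_cone_contains_0[OF C])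
  then have "(\<beta>, 1) \<in> E" using memE[of 0 0 1] linear_0[OF A] by simp
  ultimately obtain y where "y \<in> K" and y: "\<And>z r. (z, r) \<in> E \<Longrightarrow> blinfun_apply z y \<le> r"
    using conic_farkas[OF refl K, of E] \<beta> by metis
  have Ay: "blinfun_apply (A x) y \<le> 0" if "x \<in> C" for x
    using y[OF memE[OF that, of 0 0]] by simp
  \<comment> \<open>The variable \<open>s\<close> is free, so its coefficient in the certificate vanishes.\<close>
  have "blinfun_apply \<beta> y = 1"
    using y[OF memE[OF C0, of 0 1]] y[OF memE[OF C0, of 0 "-1"]] linear_0[OF A]
    by (simp add: blinfun.minus_left)
  moreover have "0 \<le> blinfun_apply b y"
    using y[OF memE[OF C0, of 1 0]] linear_0[OF A] by (simp add: blinfun.minus_left)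
  moreover have "blinfun_apply b y \<le> blinfun_apply (A x1) y"
    using x1(2) \<open>y \<in> K\<close> by (auto simp: dual_cone_def blinfun.diff_left)
  then have "blinfun_apply b y \<le> 0" using Ay[OF x1(1)] by simp
  ultimately show thesis using that \<open>y \<in> K\<close> Ay by (auto simp: strategies_def)
qed

section \<open>Conic duality under strict feasibility\<close>

lemma dual_adjoint_apply:
  assumes "has_dual_adjoint A"
  shows "blinfun_apply (dual_adjoint A y) x = blinfun_apply (A x) y"
proof -
  have "\<forall>x. blinfun_apply (dual_adjoint A y) x = blinfun_apply (A x) y"
    unfolding dual_adjoint_def by (rule theI') (use assms in \<open>simp add: has_dual_adjoint_def\<close>)
  then show ?thesis by blast
qed

lemma dual_adjoint_eqI:
  assumes "\<And>x. blinfun_apply w x = blinfun_apply (A x) y"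
  shows "dual_adjoint A y = w"
  unfolding dual_adjoint_def
proof (rule the_equality)
  show "\<forall>x. blinfun_apply w x = blinfun_apply (A x) y" using assms by blast
next
  fix w' assume "\<forall>x. blinfun_apply w' x = blinfun_apply (A x) y"
  then show "w' = w" by (intro blinfun_eqI) (simp add: assms)
qed

lemma mem_feasible_D_iff:
  assumes "has_dual_adjoint A"
  shows "y \<in> feasible_D A C K c \<longleftrightarrow>
    y \<in> K \<and> (\<forall>x\<in>C. blinfun_apply (A x) y \<le> blinfun_apply c x)"
  by (auto simp: feasible_D_def dual_cone_def dual_adjoint_apply[OF assms] blinfun.add_left
      blinfun.minus_left blinfun.diff_left)

lemma weak_duality:
  assumes "has_dual_adjoint A" "x \<in> feasible_P A C K b" "y \<in> feasible_D A C K c"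
  shows "blinfun_apply b y \<le> blinfun_apply c x"
proof -
  have "blinfun_apply b y \<le> blinfun_apply (A x) y"
    using assms by (auto simp: feasible_P_def mem_feasible_D_iff dual_cone_def blinfun.diff_left)
  also have "\<dots> \<le> blinfun_apply c x"
    using assms by (auto simp: feasible_P_def mem_feasible_D_iff)
  finally show ?thesis .
qed

lemma val_D_le_val_P:
  assumes "has_dual_adjoint A"
  shows "val_D A C K b c \<le> val_P A C K b c"
  unfolding val_D_def val_P_def
proof (intro SUP_least INF_greatest)
  fix y x assume "y \<in> feasible_D A C K c" "x \<in> feasible_P A C K b"
  then show "ereal (blinfun_apply b y) \<le> ereal (blinfun_apply c x)"
    using weak_duality[OF assms] by simp
qed

text \<open>
  A pair of feasible points without duality gap consists of optimal solutions.
\<close>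

lemma solutions_pairI:
  assumes "has_dual_adjoint A" "x \<in> feasible_P A C K b" "y \<in> feasible_D A C K c"
    and le: "blinfun_apply c x \<le> blinfun_apply b y"
  shows "val_P A C K b c = ereal (blinfun_apply c x)" "val_D A C K b c = ereal (blinfun_apply b y)"
    "x \<in> solutions_P A C K b c" "y \<in> solutions_D A C K b c"
proof -
  have P: "val_P A C K b c \<le> ereal (blinfun_apply c x)"
    unfolding val_P_def by (rule INF_lower) fact
  have D: "ereal (blinfun_apply b y) \<le> val_D A C K b c"
    unfolding val_D_def by (rule SUP_upper) fact
  have "ereal (blinfun_apply c x) \<le> ereal (blinfun_apply b y)" using le by simp
  also note D
  also note val_D_le_val_P[OF assms(1)]
  finally show valP: "val_P A C K b c = ereal (blinfun_apply c x)" using P by (rule antisym[rotated])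
  have "val_D A C K b c \<le> val_P A C K b c" by (rule val_D_le_val_P[OF assms(1)])
  also have "\<dots> \<le> ereal (blinfun_apply b y)" using valP le by simp
  finally show "val_D A C K b c = ereal (blinfun_apply b y)" using D by (rule antisym)
  with valP show "x \<in> solutions_P A C K b c" "y \<in> solutions_D A C K b c"
    using assms(2,3) by (simp_all add: solutions_P_def solutions_D_def)
qed

text \<open>
  Slater's condition for \<open>(P)\<close> closes the duality gap and makes the dual solution set nonempty and
  bounded.  Boundedness holds because the coercive functional \<open>A x0 - b\<close> of a strictly feasible
  \<open>x0\<close> is at most \<open>c x0 - val_P\<close> on the dual solutions.
\<close>

lemma strictly_feasible_P_duality:
  fixes A :: "'a::real_normed_vector \<Rightarrow> ('b::real_normed_vector \<Rightarrow>\<^sub>L real)"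
  assumes refl: "reflexive_space TYPE('b)" and A: "linear A" "has_dual_adjoint A"
    and C: "convex_cone C" and K: "closed K" "convex_cone K"
    and slater: "strictly_feasible_P A C K b" and feas: "feasible_D A C K c \<noteq> {}"
  shows "val_P A C K b c = val_D A C K b c" "solutions_D A C K b c \<noteq> {}"
    "convex (solutions_D A C K b c)" "bounded (solutions_D A C K b c)"
proof -
  obtain x0 where x0: "x0 \<in> C" "A x0 - b \<in> interior (dual_cone K)"
    using slater by (auto simp: strictly_feasible_P_def)
  then have x0_feas: "x0 \<in> feasible_P A C K b"
    using interior_subset by (auto simp: feasible_P_def)
  obtain y0 where y0: "y0 \<in> feasible_D A C K c" using feas by blast
  have "val_P A C K b c \<le> ereal (blinfun_apply c x0)"
    using x0_feas by (auto simp: val_P_def intro: INF_lower)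
  moreover have "ereal (blinfun_apply b y0) \<le> val_P A C K b c"
    unfolding val_P_def using weak_duality[OF A(2) _ y0] by (intro INF_greatest) simp
  ultimately obtain p where p: "val_P A C K b c = ereal p"
    by (cases "val_P A C K b c") auto
  have "p \<le> blinfun_apply c x" if "x \<in> feasible_P A C K b" for x
  proof -
    have "val_P A C K b c \<le> ereal (blinfun_apply c x)"
      using that by (auto simp: val_P_def intro: INF_lower)
    then show ?thesis by (simp add: p)
  qed
  then obtain y where y: "y \<in> K" "\<And>x. x \<in> C \<Longrightarrow> blinfun_apply (A x) y \<le> blinfun_apply c x"
    "p \<le> blinfun_apply b y"
    using conic_strong_duality[OF refl A(1) C K slater, of p c] by metis
  then have y_feas: "y \<in> feasible_D A C K c" by (simp add: mem_feasible_D_iff[OF A(2)])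
  have "ereal (blinfun_apply b y) \<le> val_D A C K b c"
    unfolding val_D_def using y_feas by (rule SUP_upper)
  moreover have "val_D A C K b c \<le> ereal p" using val_D_le_val_P[OF A(2), of C K b c] p by simp
  ultimately have "ereal (blinfun_apply b y) \<le> ereal p" by (rule order_trans)
  with y(3) have y_val: "blinfun_apply b y = p" by simp
  then have valD: "val_D A C K b c = ereal p"
    using \<open>ereal (blinfun_apply b y) \<le> val_D A C K b c\<close> \<open>val_D A C K b c \<le> ereal p\<close>
    by (intro antisym) simp_all
  then show "val_P A C K b c = val_D A C K b c" using p by simp
  have sol: "z \<in> solutions_D A C K b c \<longleftrightarrow> z \<in> K
    \<and> (\<forall>x\<in>C. blinfun_apply (A x) z \<le> blinfun_apply c x) \<and> blinfun_apply b z = p" for z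
    by (simp add: solutions_D_def valD mem_feasible_D_iff[OF A(2)])
  show "solutions_D A C K b c \<noteq> {}" using sol y y_val by auto
  show "convex (solutions_D A C K b c)"
  proof (rule convexI)
    fix z z' and s t :: real
    assume z: "z \<in> solutions_D A C K b c" "z' \<in> solutions_D A C K b c"
      and st: "0 \<le> s" "0 \<le> t" "s + t = 1"
    have "s *\<^sub>R z + t *\<^sub>R z' \<in> K"
      using z st by (intro convex_cone_add[OF K(2)] convex_cone_scaleR[OF K(2)]) (auto simp: sol)
    moreover have "s * blinfun_apply (A x) z + t * blinfun_apply (A x) z' \<le> blinfun_apply c x"
      if "x \<in> C" for x
      using z st that by (intro convex_bound_le) (auto simp: sol)
    moreover have "s * p + t * p = p" using st by (metis distrib_right mult_1)
    ultimately show "s *\<^sub>R z + t *\<^sub>R z' \<in> solutions_D A C K b c"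
      using z by (simp add: sol blinfun.add_right blinfun.scaleR_right)
  qed
  obtain e where "0 < e" and e: "\<And>z. z \<in> K \<Longrightarrow> e * norm z \<le> blinfun_apply (A x0 - b) z"
    using x0(2) by (auto simp: mem_interior_dual_cone_iff)
  have "norm z \<le> (blinfun_apply c x0 - p) / e" if "z \<in> solutions_D A C K b c" for z
  proof -
    have "e * norm z \<le> blinfun_apply (A x0) z - blinfun_apply b z"
      using e[of z] that by (simp add: sol blinfun.diff_left)
    also have "\<dots> \<le> blinfun_apply c x0 - p" using that x0(1) by (simp add: sol)
    finally show ?thesis using \<open>0 < e\<close> by (simp add: field_simps)
  qed
  then show "bounded (solutions_D A C K b c)" by (auto simp: bounded_iff)
qed

section \<open>Exchanging the two programs\<close>

lemma linear_minus_dual_adjoint: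
  assumes "has_dual_adjoint A"
  shows "linear (\<lambda>y. - dual_adjoint A y)"
  by (intro linearI blinfun_eqI)
    (simp_all add: dual_adjoint_apply[OF assms] blinfun.add_left blinfun.add_right
      blinfun.minus_left blinfun.diff_left blinfun.scaleR_left blinfun.scaleR_right)

lemma has_dual_adjoint_minus_dual_adjoint:
  assumes "has_dual_adjoint A"
  shows "has_dual_adjoint (\<lambda>y. - dual_adjoint A y)"
  unfolding has_dual_adjoint_def
proof (intro allI ex1I)
  show "blinfun_apply (- A x) y = blinfun_apply (- dual_adjoint A y) x" for x y
    by (simp add: blinfun.minus_left dual_adjoint_apply[OF assms])
next
  fix x w assume "\<forall>y. blinfun_apply w y = blinfun_apply (- dual_adjoint A y) x"
  then show "w = - A x"
    by (intro blinfun_eqI) (simp add: blinfun.minus_left dual_adjoint_apply[OF assms])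
qed

lemma dual_adjoint_minus_dual_adjoint:
  assumes "has_dual_adjoint A"
  shows "dual_adjoint (\<lambda>y. - dual_adjoint A y) x = - A x"
  by (intro dual_adjoint_eqI) (simp add: blinfun.minus_left dual_adjoint_apply[OF assms])

text \<open>
  Replacing \<open>(A, C, K, b, c)\<close> by \<open>(- dual_adjoint A, K, C, - c, - b)\<close> exchanges the two programs
  and changes the sign of their values.  Every result on \<open>(P)\<close> thus has a counterpart for \<open>(D)\<close>.
\<close>

lemma swapped_programs:
  fixes A :: "'a::real_normed_vector \<Rightarrow> ('b::real_normed_vector \<Rightarrow>\<^sub>L real)"
  assumes "has_dual_adjoint A"
  defines "A' \<equiv> \<lambda>y. - dual_adjoint A y"
  shows "feasible_P A' K C (- c) = feasible_D A C K c"
    and "feasible_D A' K C (- b) = feasible_P A C K b"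
    and "strictly_feasible_P A' K C (- c) \<longleftrightarrow> strictly_feasible_D A C K c"
    and "val_P A' K C (- c) (- b) = - val_D A C K b c"
    and "val_D A' K C (- c) (- b) = - val_P A C K b c"
    and "solutions_D A' K C (- c) (- b) = solutions_P A C K b c"
proof -
  show P: "feasible_P A' K C (- c) = feasible_D A C K c"
    by (simp add: feasible_P_def feasible_D_def A'_def)
  show D: "feasible_D A' K C (- b) = feasible_P A C K b"
    by (simp add: feasible_P_def feasible_D_def A'_def dual_adjoint_minus_dual_adjoint[OF assms(1)])
  show "strictly_feasible_P A' K C (- c) \<longleftrightarrow> strictly_feasible_D A C K c"
    by (simp add: strictly_feasible_P_def strictly_feasible_D_def A'_def)
  show "val_P A' K C (- c) (- b) = - val_D A C K b c"
    unfolding val_P_def val_D_def P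
    by (simp add: blinfun.minus_left ereal_INF_uminus_eq flip: uminus_ereal.simps)
  show val: "val_D A' K C (- c) (- b) = - val_P A C K b c"
    unfolding val_P_def val_D_def D
    by (simp add: blinfun.minus_left ereal_SUP_uminus_eq flip: uminus_ereal.simps)
  show "solutions_D A' K C (- c) (- b) = solutions_P A C K b c"
    unfolding solutions_D_def solutions_P_def D val
    by (simp add: blinfun.minus_left flip: uminus_ereal.simps)
qed

lemma strictly_feasible_D_duality:
  fixes A :: "'a::real_normed_vector \<Rightarrow> ('b::real_normed_vector \<Rightarrow>\<^sub>L real)"
  assumes refl: "reflexive_space TYPE('a)" and A: "has_dual_adjoint A"
    and C: "closed C" "convex_cone C" and K: "convex_cone K"
    and slater: "strictly_feasible_D A C K c" and feas: "feasible_P A C K b \<noteq> {}"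
  shows "val_P A C K b c = val_D A C K b c" "solutions_P A C K b c \<noteq> {}"
    "convex (solutions_P A C K b c)" "bounded (solutions_P A C K b c)"
proof -
  note swap = swapped_programs[OF A, of K C]
  have "strictly_feasible_P (\<lambda>y. - dual_adjoint A y) K C (- c)"
    "feasible_D (\<lambda>y. - dual_adjoint A y) K C (- b) \<noteq> {}"
    using slater feas by (simp_all add: swap)
  from strictly_feasible_P_duality[OF refl linear_minus_dual_adjoint[OF A]
      has_dual_adjoint_minus_dual_adjoint[OF A] K C this]
  show "val_P A C K b c = val_D A C K b c" "solutions_P A C K b c \<noteq> {}"
    "convex (solutions_P A C K b c)" "bounded (solutions_P A C K b c)"
    by (simp_all add: swap)
qed

lemma strictly_feasible_D_alternative:
  fixes A :: "'a::real_normed_vector \<Rightarrow> ('b::real_normed_vector \<Rightarrow>\<^sub>L real)"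
  assumes refl: "reflexive_space TYPE('a)" and A: "has_dual_adjoint A"
    and C: "closed C" "convex_cone C" and K: "convex_cone K"
    and \<alpha>: "\<alpha> \<in> interior (dual_cone C)"
    and feas: "feasible_D A C K c \<noteq> {}" and not_strict: "\<not> strictly_feasible_D A C K c"
  obtains x where "x \<in> strategies \<alpha> C" "blinfun_apply c x = 0"
    "\<And>y. y \<in> K \<Longrightarrow> 0 \<le> blinfun_apply (A x) y"
proof -
  note swap = swapped_programs[OF A, of K C]
  have "feasible_P (\<lambda>y. - dual_adjoint A y) K C (- c) \<noteq> {}"
    "\<not> strictly_feasible_P (\<lambda>y. - dual_adjoint A y) K C (- c)"
    using not_strict feas by (simp_all add: swap)
  then obtain x where "x \<in> strategies \<alpha> C" "blinfun_apply (- c) x = 0"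
    and "\<And>y. y \<in> K \<Longrightarrow> blinfun_apply (- dual_adjoint A y) x \<le> 0"
    using strictly_feasible_P_alternative[OF refl linear_minus_dual_adjoint[OF A] K C \<alpha>] by blast
  then show thesis
    by (intro that[of x]) (simp_all add: blinfun.minus_left dual_adjoint_apply[OF A])
qed

section \<open>Optimal strategies and strict feasibility\<close>

text \<open>
  A saddle point at height \<open>v\<close> shows that the game has a value and that this value is \<open>v\<close>.
\<close>

lemma game_value_eqI:
  assumes x: "x \<in> S" "\<And>y. y \<in> T \<Longrightarrow> v \<le> u x y" and y: "y \<in> T" "\<And>x. x \<in> S \<Longrightarrow> u x y \<le> v"
  shows "game_value S T u = v"
proof -
  have "lower_value S T u = ereal v"
    unfolding lower_value_def
  proof (rule antisym)
    show "(SUP x\<in>S. INF y\<in>T. ereal (u x y)) \<le> ereal v"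
      using y by (intro SUP_least INF_lower2[of y]) auto
    show "ereal v \<le> (SUP x\<in>S. INF y\<in>T. ereal (u x y))"
      using x by (intro SUP_upper2[of x] INF_greatest) auto
  qed
  moreover have "upper_value S T u = ereal v"
    unfolding upper_value_def
  proof (rule antisym)
    show "(INF y\<in>T. SUP x\<in>S. ereal (u x y)) \<le> ereal v"
      using y by (intro INF_lower2[of y] SUP_least) auto
    show "ereal v \<le> (INF y\<in>T. SUP x\<in>S. ereal (u x y))"
      using x by (intro INF_greatest SUP_upper2[of x]) auto
  qed
  ultimately show ?thesis unfolding game_value_def by (intro the_equality) auto
qed

text \<open>
  The converse of the alternative: the functional of a strictly feasible point would be positive at
  the nonzero strategy \<open>y\<close>.
\<close>

lemma not_strictly_feasible_P:
  assumes y: "y \<in> strategies \<beta> K" "blinfun_apply b y = 0"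
    and le: "\<And>x. x \<in> C \<Longrightarrow> blinfun_apply (A x) y \<le> 0"
  shows "\<not> strictly_feasible_P A C K b"
proof
  assume "strictly_feasible_P A C K b"
  then obtain x where "x \<in> C" "A x - b \<in> interior (dual_cone K)"
    by (auto simp: strictly_feasible_P_def)
  moreover have "y \<in> K" "y \<noteq> 0" using y(1) by (auto simp: strategies_def)
  ultimately obtain e where "0 < e" "e * norm y \<le> blinfun_apply (A x - b) y"
    by (auto simp: mem_interior_dual_cone_iff)
  moreover have "blinfun_apply (A x - b) y \<le> 0"
    using le[OF \<open>x \<in> C\<close>] y(2) by (simp add: blinfun.diff_left)
  moreover have "0 < e * norm y" using \<open>0 < e\<close> \<open>y \<noteq> 0\<close> by simp
  ultimately show False by linarith
qed

lemma not_strictly_feasible_D: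
  assumes A: "has_dual_adjoint A" and x: "x \<in> strategies \<alpha> C" "blinfun_apply c x = 0"
    and ge: "\<And>y. y \<in> K \<Longrightarrow> 0 \<le> blinfun_apply (A x) y"
  shows "\<not> strictly_feasible_D A C K c"
  using not_strictly_feasible_P[OF x(1), of "- c" K "\<lambda>y. - dual_adjoint A y"] x(2) ge
  by (simp add: swapped_programs[OF A] blinfun.minus_left dual_adjoint_apply[OF A])

text \<open>
  Since \<open>\<beta>\<close> is positive on \<open>K - {0}\<close>, each nonzero element of \<open>K\<close> is a positive multiple of a
  strategy, so a sign condition on the strategies extends to the cone.
\<close>

lemma strategies_sign_extends:
  fixes w :: "'b::real_normed_vector \<Rightarrow>\<^sub>L real"
  assumes K: "cone K" and \<beta>: "\<beta> \<in> interior (dual_cone K)"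
    and ge: "\<And>y. y \<in> strategies \<beta> K \<Longrightarrow> 0 \<le> blinfun_apply w y" and "y \<in> K"
  shows "0 \<le> blinfun_apply w y"
proof (cases "y = 0")
  case False
  obtain e where "0 < e" and "e * norm y \<le> blinfun_apply \<beta> y"
    using \<beta> \<open>y \<in> K\<close> by (auto simp: mem_interior_dual_cone_iff)
  moreover have "0 < e * norm y" using \<open>0 < e\<close> False by simp
  ultimately have pos: "0 < blinfun_apply \<beta> y" by linarith
  then have "(1 / blinfun_apply \<beta> y) *\<^sub>R y \<in> strategies \<beta> K"
    using mem_cone[OF K \<open>y \<in> K\<close>] by (simp add: strategies_def blinfun.scaleR_right)
  from ge[OF this] pos show ?thesis by (simp add: blinfun.scaleR_right zero_le_divide_iff)
qed simp

theorem theorem4p1: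
  fixes A :: "'a::banach \<Rightarrow> ('b::banach \<Rightarrow>\<^sub>L real)"
    and C :: "'a set" and K :: "'b set"
    and c \<alpha> :: "'a \<Rightarrow>\<^sub>L real" and b \<beta> :: "'b \<Rightarrow>\<^sub>L real"
    and S :: "'a set" and T :: "'b set"
    and v :: real and B1 :: "'a set" and B2 :: "'b set"
  assumes "reflexive_space TYPE('a)" and "reflexive_space TYPE('b)"
    and "linear A" and "has_dual_adjoint A"
    and "closed C" and "cone C" and "convex C"
    and "closed K" and "cone K" and "convex K"
    and "interior (dual_cone C) \<noteq> {}" and "interior (dual_cone K) \<noteq> {}"
    and "feasible_P A C K b \<noteq> {}" and "feasible_D A C K c \<noteq> {}"
    and "\<alpha> \<in> interior (dual_cone C)" and "\<beta> \<in> interior (dual_cone K)"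
    and "S = strategies \<alpha> C" and "T = strategies \<beta> K"
    and "S \<noteq> {}" and "T \<noteq> {}"
    and "v = game_value S T (payoff A)"
    and "B1 = optimal_I S T (payoff A)" and "B2 = optimal_II S T (payoff A)"
  shows
    "(v \<noteq> 0 \<longrightarrow>
        (strictly_feasible_P A C K b \<or> strictly_feasible_D A C K c)
      \<and> val_P A C K b c = val_D A C K b c
      \<and> ((solutions_P A C K b c \<noteq> {} \<and> convex (solutions_P A C K b c)
            \<and> bounded (solutions_P A C K b c))
        \<or> (solutions_D A C K b c \<noteq> {} \<and> convex (solutions_D A C K b c)
            \<and> bounded (solutions_D A C K b c))))
   \<and> (v = 0 \<and> (B1 \<inter> perp c = {} \<or> B2 \<inter> perp b = {}) \<longrightarrow>
        (strictly_feasible_P A C K b \<or> strictly_feasible_D A C K c)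
      \<and> val_P A C K b c = val_D A C K b c
      \<and> ((solutions_P A C K b c \<noteq> {} \<and> convex (solutions_P A C K b c)
            \<and> bounded (solutions_P A C K b c))
        \<or> (solutions_D A C K b c \<noteq> {} \<and> convex (solutions_D A C K b c)
            \<and> bounded (solutions_D A C K b c))))
   \<and> (v = 0 \<and> B1 \<inter> perp c \<noteq> {} \<and> B2 \<inter> perp b \<noteq> {} \<longrightarrow>
        \<not> strictly_feasible_P A C K b \<and> \<not> strictly_feasible_D A C K c
      \<and> (B1 \<inter> perp c \<inter> feasible_P A C K b \<noteq> {} \<and>
         B2 \<inter> perp b \<inter> feasible_D A C K c \<noteq> {} \<longrightarrow>
           val_P A C K b c = 0 \<and> val_D A C K b c = 0
         \<and> B1 \<inter> solutions_P A C K b c \<noteq> {}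
         \<and> B2 \<inter> solutions_D A C K b c \<noteq> {}))"
proof -
  note refl = assms(1,2) and lin = assms(3) and adj = assms(4)
    and feas_P = assms(13) and feas_D = assms(14) and \<alpha> = assms(15) and \<beta> = assms(16)
    and S_eq = assms(17) and T_eq = assms(18) and v_eq = assms(21)
  have zero: "0 \<in> C" "0 \<in> K"
    using feas_P feas_D cone_contains_0[OF \<open>cone C\<close>] cone_contains_0[OF \<open>cone K\<close>]
    by (auto simp: feasible_P_def feasible_D_def)
  have C: "convex_cone C" and K: "convex_cone K"
    using zero \<open>cone C\<close> \<open>convex C\<close> \<open>cone K\<close> \<open>convex K\<close>
    by (auto simp: convex_cone_def conic_def cone_def)
  have B1_iff: "x \<in> B1 \<longleftrightarrow> x \<in> S \<and> (\<forall>y\<in>T. v \<le> blinfun_apply (A x) y)" for x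
    by (simp add: assms(22) optimal_I_def payoff_def v_eq)
  have B2_iff: "y \<in> B2 \<longleftrightarrow> y \<in> T \<and> (\<forall>x\<in>S. blinfun_apply (A x) y \<le> v)" for y
    by (simp add: assms(23) optimal_II_def payoff_def v_eq)
  let ?strict = "strictly_feasible_P A C K b \<or> strictly_feasible_D A C K c"
  let ?regular = "?strict
      \<and> val_P A C K b c = val_D A C K b c
      \<and> ((solutions_P A C K b c \<noteq> {} \<and> convex (solutions_P A C K b c)
            \<and> bounded (solutions_P A C K b c))
        \<or> (solutions_D A C K b c \<noteq> {} \<and> convex (solutions_D A C K b c)
            \<and> bounded (solutions_D A C K b c)))"
  have regular: ?regular if ?strict
    using that strictly_feasible_P_duality[OF refl(2) lin adj C \<open>closed K\<close> K _ feas_D]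
      strictly_feasible_D_duality[OF refl(1) adj \<open>closed C\<close> C K _ feas_P] by blast
  have singular: "v = 0 \<and> B1 \<inter> perp c \<noteq> {} \<and> B2 \<inter> perp b \<noteq> {}" if not_strict: "\<not> ?strict"
  proof -
    obtain y where y: "y \<in> T" "blinfun_apply b y = 0"
      "\<And>x. x \<in> C \<Longrightarrow> blinfun_apply (A x) y \<le> 0"
      using strictly_feasible_P_alternative[OF refl(2) lin C \<open>closed K\<close> K \<beta> feas_P] not_strict
      unfolding T_eq by blast
    obtain x where x: "x \<in> S" "blinfun_apply c x = 0"
      "\<And>y. y \<in> K \<Longrightarrow> 0 \<le> blinfun_apply (A x) y"
      using strictly_feasible_D_alternative[OF refl(1) adj \<open>closed C\<close> C K \<alpha> feas_D] not_strict
      unfolding S_eq by blast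
    have SC: "S \<subseteq> C" "T \<subseteq> K" by (auto simp: S_eq T_eq strategies_def)
    have "v = 0"
      unfolding v_eq using x y SC by (intro game_value_eqI[of x _ _ _ _ y]) (auto simp: payoff_def)
    moreover have "x \<in> B1 \<inter> perp c" "y \<in> B2 \<inter> perp b"
      using x y SC \<open>v = 0\<close> by (auto simp: B1_iff B2_iff perp_def)
    ultimately show ?thesis by blast
  qed
  \<comment> \<open>In a game of value 0, optimality of a strategy is a condition on the whole opposing cone.\<close>
  have opt_I: "0 \<le> blinfun_apply (A x) y" if "v = 0" "x \<in> B1" "y \<in> K" for x y
    using that strategies_sign_extends[OF \<open>cone K\<close> \<beta>, of "A x"] by (simp add: B1_iff T_eq)
  have opt_II: "blinfun_apply (A x) y \<le> 0" if "v = 0" "y \<in> B2" "x \<in> C" for x y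
    using that strategies_sign_extends[OF \<open>cone C\<close> \<alpha>, of "- dual_adjoint A y"]
    by (simp add: B2_iff S_eq blinfun.minus_left dual_adjoint_apply[OF adj])
  have part3: "\<not> strictly_feasible_P A C K b \<and> \<not> strictly_feasible_D A C K c"
    if v: "v = 0" and x: "x \<in> B1 \<inter> perp c" and y: "y \<in> B2 \<inter> perp b" for x y
  proof
    have "y \<in> strategies \<beta> K" "x \<in> strategies \<alpha> C"
      using x y by (auto simp: B1_iff B2_iff S_eq T_eq)
    then show "\<not> strictly_feasible_P A C K b" "\<not> strictly_feasible_D A C K c"
      using not_strictly_feasible_P[of y \<beta> K b C A] not_strictly_feasible_D[OF adj, of x \<alpha> C c K]
        x y opt_I[OF v] opt_II[OF v] by (auto simp: perp_def)
  qed
  have solutions: "val_P A C K b c = 0 \<and> val_D A C K b c = 0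
      \<and> B1 \<inter> solutions_P A C K b c \<noteq> {} \<and> B2 \<inter> solutions_D A C K b c \<noteq> {}"
    if x: "x \<in> B1 \<inter> perp c \<inter> feasible_P A C K b" and y: "y \<in> B2 \<inter> perp b \<inter> feasible_D A C K c"
    for x y
  proof -
    have "blinfun_apply c x = 0" "blinfun_apply b y = 0" using x y by (auto simp: perp_def)
    then show ?thesis
      using solutions_pairI[OF adj, of x C K b y c] x y by (auto simp: zero_ereal_def)
  qed
  show ?thesis
  proof (intro conjI[of "_ \<longrightarrow> _"] impI; (elim conjE)?)
    show ?regular if "v \<noteq> 0" using that singular regular by blast
    show ?regular if "B1 \<inter> perp c = {} \<or> B2 \<inter> perp b = {}" using that singular regular by blast
  next
    assume "v = 0" "B1 \<inter> perp c \<noteq> {}" "B2 \<inter> perp b \<noteq> {}"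
    then show "\<not> strictly_feasible_P A C K b \<and> \<not> strictly_feasible_D A C K c
      \<and> (B1 \<inter> perp c \<inter> feasible_P A C K b \<noteq> {} \<and>
         B2 \<inter> perp b \<inter> feasible_D A C K c \<noteq> {} \<longrightarrow>
           val_P A C K b c = 0 \<and> val_D A C K b c = 0
         \<and> B1 \<inter> solutions_P A C K b c \<noteq> {}
         \<and> B2 \<inter> solutions_D A C K b c \<noteq> {})"
      using part3 solutions by (meson ex_in_conv)
  qed
qed

end
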